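(* Let $a<b$ be real numbers, let $\psi_1,\psi_2,f:\mathbb{R}\to\mathbb{R}$ and $q\in C([a,b],\mathbb{R})$ satisfy the standing hypotheses (i)–(v) listed in the context, and suppose that the equation $$(\psi_{2}((\psi_{1}(u'))'))' + q(x)f(u) = 0$$ has a nontrivial solution $u(x)$. Suppose $\{t_{k}\}_{k=1}^{2N+1}$, $N\in\mathbb{N}$ (with $N\ge 1$), is an increasing sequence of zeroes of $u(x)$ in the compact interval $[a,b]$. Then $$N < \left[\psi_{2}\left(\frac{\frac{2}{b-a}}{\psi_{1}\left(\frac{b-a}{2}\right)}\right)\right]^{-1}\sum_{k=1}^{N}\max_{\xi_{k}\in [t_{2k-1},t_{2k+1}]}\left\{\int_{t_{2k-1}}^{\xi_{k}}q_{-}(x)\Phi(u(x))\,dx + \int_{\xi_{k}}^{t_{2k+1}}q_{+}(x)\Phi(u(x))\,dx\right\},$$ where $\Phi(s) = \dfrac{f(s)}{\psi_{2}(\psi_{1}(s))}$.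
   Context: Standing hypotheses: (i) $\psi_1$ and $\psi_2$ are odd and (strictly) increasing functions $\mathbb{R}\to\mathbb{R}$; (ii) $\psi_1$ is sub-multiplicative on $[0,\infty)$, i.e. $\psi_1(xy)\le\psi_1(x)\psi_1(y)$ for all $x,y\ge 0$, and $1/\psi_1(s)$ is a convex function for $s>0$; (iii) $\psi_2$ is super-multiplicative on $[0,\infty)$, i.e. $\psi_2(xy)\ge\psi_2(x)\psi_2(y)$ for all $x,y\ge 0$; (iv) $q\in C([a,b],\mathbb{R})$, and $q$ may change sign; (v) $f:\mathbb{R}\to\mathbb{R}$ is odd, continuous and satisfies $sf(s)>0$ for $s\ne 0$. Notation: $q_+(x)=\max\{q(x),0\}$ and $q_-(x)=\max\{-q(x),0\}$. A solution is a real function $u$ such that $u$, $\psi_1(u')$ and $\psi_2((\psi_1(u'))')$ are continuously differentiable and the equation holds pointwise (here on $[a,b]$); nontrivial means not identically zero. The function $\Phi(s)$ is defined (and positive) for $s\neq 0$; integrals involving $\Phi(u(x))$ are taken over the points where $u(x)\ne 0$, and are allowed to take the value $+\infty$.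
   Formalization: The solution u is additionally assumed not identically zero on each interval [t_{2k-1}, t_{2k+1}]; without this the claim fails, e.g. ψ1=ψ2=id, f(s)=120 sgn(s)|s|^{1/2}, q=-1, u=max(0,x-1)^6 on [0,2], zeroes 0, 1/2, 1. *)

theory Defs
  imports "HOL-Analysis.Analysis"
begin

text \<open>
  Derivatives are taken within the set, hence one-sided at the endpoints of a compact interval;
  the values of the function outside the set are irrelevant.
\<close>

definition C1_with_derivative_on ::
    "real set \<Rightarrow> (real \<Rightarrow> real) \<Rightarrow> (real \<Rightarrow> real) \<Rightarrow> bool" where
  "C1_with_derivative_on S g g' \<longleftrightarrow>
     (\<forall>x\<in>S. (g has_real_derivative g' x) (at x within S)) \<and> continuous_on S g'"

text \<open>
  In the following definition \<open>u'\<close>, \<open>v'\<close> and \<open>w'\<close> are the derivatives on \<open>[a,b]\<close> of \<open>u\<close>,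
  of \<open>v = \<psi>\<^sub>1(u')\<close> and of \<open>w = \<psi>\<^sub>2(v')\<close>. For \<open>a < b\<close> they are uniquely determined on \<open>[a,b]\<close>.
\<close>

definition is_solution ::
    "real \<Rightarrow> real \<Rightarrow> (real \<Rightarrow> real) \<Rightarrow> (real \<Rightarrow> real) \<Rightarrow> (real \<Rightarrow> real) \<Rightarrow> (real \<Rightarrow> real) \<Rightarrow> (real \<Rightarrow> real) \<Rightarrow> bool"
  where
  "is_solution a b \<psi>1 \<psi>2 q f u \<longleftrightarrow>
     (\<exists>u' v' w'.
        C1_with_derivative_on {a..b} u u' \<and>
        C1_with_derivative_on {a..b} (\<lambda>x. \<psi>1 (u' x)) v' \<and>
        C1_with_derivative_on {a..b} (\<lambda>x. \<psi>2 (v' x)) w' \<and>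
        (\<forall>x\<in>{a..b}. w' x + q x * f (u x) = 0))"

text \<open>
  Since \<open>f\<close> is merely continuous, a solution that is nontrivial on \<open>[a,b]\<close> may vanish on a whole
  subinterval (e.g. \<open>u(x) = max(0,x-1)^6\<close> solves \<open>u''' = 120 sgn(u) |u|^(1/2)\<close>), so nontriviality
  is a condition relative to a set.
\<close>

definition nontrivial_on :: "real set \<Rightarrow> (real \<Rightarrow> real) \<Rightarrow> bool" where
  "nontrivial_on S u \<longleftrightarrow> (\<exists>x\<in>S. u x \<noteq> 0)"

definition Phi ::
    "(real \<Rightarrow> real) \<Rightarrow> (real \<Rightarrow> real) \<Rightarrow> (real \<Rightarrow> real) \<Rightarrow> real \<Rightarrow> real" where
  "Phi \<psi>1 \<psi>2 f s = f s / \<psi>2 (\<psi>1 s)"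

definition pos_part :: "(real \<Rightarrow> real) \<Rightarrow> real \<Rightarrow> real" where
  "pos_part q x = max (q x) 0"

definition neg_part :: "(real \<Rightarrow> real) \<Rightarrow> real \<Rightarrow> real" where
  "neg_part q x = max (- q x) 0"

text \<open>
  The integral of \<open>p(x) \<Phi>(u(x))\<close> over the points of \<open>[c,d]\<close> at which \<open>u \<noteq> 0\<close>, as an extended
  nonnegative real. For \<open>p \<ge> 0\<close> the integrand is nonnegative there, so the truncation
  performed by \<open>ennreal\<close> is harmless.
\<close>

definition weighted_integral ::
    "(real \<Rightarrow> real) \<Rightarrow> (real \<Rightarrow> real) \<Rightarrow> (real \<Rightarrow> real) \<Rightarrow> (real \<Rightarrow> real) \<Rightarrow> (real \<Rightarrow> real)
       \<Rightarrow> real \<Rightarrow> real \<Rightarrow> ennreal" where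
  "weighted_integral \<psi>1 \<psi>2 f p u c d =
     (\<integral>\<^sup>+x\<in>{x\<in>{c..d}. u x \<noteq> 0}. ennreal (p x * Phi \<psi>1 \<psi>2 f (u x)) \<partial>lborel)"

text \<open>
  The maximum over \<open>\<xi> \<in> [c,d]\<close>, written as a supremum in \<open>ennreal\<close>. It is attained: either some
  \<open>\<xi>\<close> gives the value \<open>\<infinity>\<close>, or both integrands are integrable over all of \<open>[c,d]\<close> (take \<open>\<xi> = d\<close>
  and \<open>\<xi> = c\<close>) and the expression is continuous in \<open>\<xi>\<close>.
\<close>

definition max_split_integral ::
    "(real \<Rightarrow> real) \<Rightarrow> (real \<Rightarrow> real) \<Rightarrow> (real \<Rightarrow> real) \<Rightarrow> (real \<Rightarrow> real) \<Rightarrow> (real \<Rightarrow> real)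
       \<Rightarrow> real \<Rightarrow> real \<Rightarrow> ennreal" where
  "max_split_integral \<psi>1 \<psi>2 q f u c d =
     (SUP \<xi>\<in>{c..d}. weighted_integral \<psi>1 \<psi>2 f (neg_part q) u c \<xi>
                   + weighted_integral \<psi>1 \<psi>2 f (pos_part q) u \<xi> d)"

end

theory Submission
  imports Defs
begin

text \<open>
  Write \<open>v = \<psi>\<^sub>1(u')\<close> and \<open>w = \<psi>\<^sub>2(v')\<close>, so that \<open>w' = - q f(u)\<close>. The estimate is local: each triple
  of consecutive zeros \<open>c < p < d\<close> of the sequence contributes one summand, and that summand alone
  exceeds \<open>\<psi>\<^sub>2(K)\<close>, where \<open>K = (2/L) / \<psi>\<^sub>1(L/2)\<close> and \<open>L = b - a\<close>. Adding \<open>N\<close> of these strict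
  inequalities and dividing by \<open>\<psi>\<^sub>2(K) > 0\<close> gives the claim.

  For one triple, call \<open>[\<alpha>,\<beta>]\<close> a hump of \<open>u\<close> if \<open>u\<close> vanishes at both ends and nowhere in between.
  The zeros may be separated by many humps, or by intervals on which \<open>u\<close> vanishes identically, and a
  zero of \<open>v'\<close> produced by applying Rolle's theorem twice might fall between the humps. Nevertheless
  some hump in \<open>[c,d]\<close> contains a flex, that is, a point \<open>\<xi>\<close> with \<open>v'(\<xi>) = 0\<close> (lemma
  \<open>hump_with_flex_exists\<close>): on a positive hump without flex, \<open>v\<close> decreases strictly through \<open>0\<close>, so
  that \<open>u\<close> crosses the axis at both ends. At least one end lies inside \<open>(c,d)\<close>, as the hump does not
  contain \<open>p\<close> in its interior, and there a negative hump begins; if it had no flex either, then \<open>v'\<close>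
  would have to be both negative and positive at the common end.

  On a positive hump with flex \<open>\<xi>\<close> and maximum \<open>m = u(z)\<close>, integrating \<open>w' = - q f(u)\<close> from \<open>\<xi>\<close>
  bounds \<open>- w\<close> by \<open>\<psi>\<^sub>2(\<psi>\<^sub>1(m))\<close> times the integral of \<open>q\<^sub>+ \<Phi>(u)\<close> to the right of \<open>\<xi>\<close>, and times that of
  \<open>q\<^sub>- \<Phi>(u)\<close> to the left of \<open>\<xi>\<close>. If the two integrals added up to at most \<open>\<psi>\<^sub>2(K)\<close>, super-multiplicativity
  would give \<open>- v' \<le> K \<psi>\<^sub>1(m)\<close>. Since \<open>u'(z) = 0\<close>, the mean value theorem, applied to \<open>u\<close> and then
  to \<open>v\<close> between \<open>z\<close> and an end at distance \<open>\<delta> \<le> L/2\<close>, would then yield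
  \<open>\<psi>\<^sub>1(m/\<delta>) < \<delta> K \<psi>\<^sub>1(m)\<close>. By sub-multiplicativity this is \<open>1 < K \<delta> \<psi>\<^sub>1(\<delta>)\<close>, whereas
  \<open>K \<delta> \<psi>\<^sub>1(\<delta>) \<le> K (L/2) \<psi>\<^sub>1(L/2) = 1\<close> (lemma \<open>hump_inequality_pos\<close>).
\<close>

section \<open>Solutions and their derivatives\<close>

text \<open>
  The derivatives of a solution are named here, because the flex of a hump is a condition on \<open>v'\<close>.
\<close>

definition solves_on where
  "solves_on S \<psi>1 \<psi>2 q f u u' v' w' \<longleftrightarrow>
     C1_with_derivative_on S u u' \<and>
     C1_with_derivative_on S (\<lambda>x. \<psi>1 (u' x)) v' \<and>
     C1_with_derivative_on S (\<lambda>x. \<psi>2 (v' x)) w' \<and>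
     (\<forall>x\<in>S. w' x + q x * f (u x) = 0)"

lemma C1_with_derivative_on_subset:
  "C1_with_derivative_on S g g' \<Longrightarrow> T \<subseteq> S \<Longrightarrow> C1_with_derivative_on T g g'"
  unfolding C1_with_derivative_on_def
  by (meson DERIV_subset continuous_on_subset subsetD)

lemma C1_with_derivative_on_uminus:
  "C1_with_derivative_on S g g' \<Longrightarrow> C1_with_derivative_on S (\<lambda>x. - g x) (\<lambda>x. - g' x)"
  unfolding C1_with_derivative_on_def
  by (auto intro!: derivative_eq_intros continuous_intros)

lemma C1_with_derivative_on_cmult:
  "C1_with_derivative_on S g g' \<Longrightarrow> C1_with_derivative_on S (\<lambda>x. c * g x) (\<lambda>x. c * g' x)"
  unfolding C1_with_derivative_on_def
  by (auto intro!: DERIV_cmult continuous_intros)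

lemma C1_with_derivative_on_imp_continuous_on:
  "C1_with_derivative_on S g g' \<Longrightarrow> continuous_on S g"
  unfolding C1_with_derivative_on_def by (meson DERIV_continuous_on)

lemma C1_with_derivative_on_mvt:
  assumes "C1_with_derivative_on S g g'" "{x..y} \<subseteq> S" "x < y"
  obtains z where "x < z" "z < y" "g y - g x = g' z * (y - x)"
proof -
  have "\<exists>z\<in>{x<..<y}. g y - g x = g' z * (y - x)"
  proof (rule mvt_simple[OF assms(3), of g "\<lambda>z. (*) (g' z)"])
    show "(g has_derivative (*) (g' z)) (at z within {x..y})" if "x \<le> z" "z \<le> y" for z
      using C1_with_derivative_on_subset[OF assms(1,2)] that
      unfolding C1_with_derivative_on_def has_field_derivative_def by simp
  qed
  then show thesis using that by auto
qed
lemma solves_on_subset: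
  "solves_on S \<psi>1 \<psi>2 q f u u' v' w' \<Longrightarrow> T \<subseteq> S \<Longrightarrow> solves_on T \<psi>1 \<psi>2 q f u u' v' w'"
  unfolding solves_on_def by (blast intro: C1_with_derivative_on_subset)

lemma solves_on_uminus:
  assumes "\<And>s. \<psi>1 (- s) = - \<psi>1 s" "\<And>s. \<psi>2 (- s) = - \<psi>2 s" "\<And>s. f (- s) = - f s"
    and "solves_on S \<psi>1 \<psi>2 q f u u' v' w'"
  shows "solves_on S \<psi>1 \<psi>2 q f (\<lambda>x. - u x) (\<lambda>x. - u' x) (\<lambda>x. - v' x) (\<lambda>x. - w' x)"
  using assms(4) unfolding solves_on_def assms(1-3)
  by (auto intro: C1_with_derivative_on_uminus simp: add_eq_0_iff)

lemma odd_strict_mono_zero_and_sign: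
  fixes \<psi> :: "real \<Rightarrow> real"
  assumes "\<And>s. \<psi> (- s) = - \<psi> s" "strict_mono \<psi>"
  shows "\<psi> 0 = 0" "\<psi> s > 0 \<longleftrightarrow> s > 0" "\<psi> s < 0 \<longleftrightarrow> s < 0"
proof -
  show "\<psi> 0 = 0" using assms(1)[of 0] by simp
  then show "\<psi> s > 0 \<longleftrightarrow> s > 0" "\<psi> s < 0 \<longleftrightarrow> s < 0"
    using strict_mono_less[OF assms(2), of 0 s] strict_mono_less[OF assms(2), of s 0] by auto
qed

section \<open>Humps\<close>

definition hump :: "(real \<Rightarrow> real) \<Rightarrow> real \<Rightarrow> real \<Rightarrow> bool" where
  "hump u \<alpha> \<beta> \<longleftrightarrow> \<alpha> < \<beta> \<and> u \<alpha> = 0 \<and> u \<beta> = 0 \<and> (\<forall>x\<in>{\<alpha><..<\<beta>}. u x \<noteq> 0)"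

lemma hump_uminus: "hump u \<alpha> \<beta> \<Longrightarrow> hump (\<lambda>x. - u x) \<alpha> \<beta>"
  unfolding hump_def by simp

lemma nonzero_imp_same_sign:
  fixes g :: "real \<Rightarrow> real"
  assumes "continuous_on S g" "connected S" "\<And>z. z \<in> S \<Longrightarrow> g z \<noteq> 0" "x \<in> S" "y \<in> S"
  shows "g x * g y > 0"
proof (rule ccontr)
  assume "\<not> g x * g y > 0"
  then have "g x \<le> 0 \<and> 0 \<le> g y \<or> g y \<le> 0 \<and> 0 \<le> g x"
    by (metis linorder_linear less_eq_real_def mult_pos_pos mult_neg_neg)
  moreover have "connected (g ` S)"
    using assms(1,2) by (rule connected_continuous_image)
  ultimately have "0 \<in> g ` S"
    using assms(4,5) unfolding connected_iff_interval by (meson image_eqI)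
  then show False using assms(3) by force
qed

lemma hump_same_sign:
  assumes "hump u \<alpha> \<beta>" "continuous_on {\<alpha>..\<beta>} u" "x \<in> {\<alpha><..<\<beta>}" "y \<in> {\<alpha><..<\<beta>}"
  shows "u x * u y > 0"
proof (rule nonzero_imp_same_sign[of "{\<alpha><..<\<beta>}" u x y])
  show "continuous_on {\<alpha><..<\<beta>} u"
    using assms(2) by (rule continuous_on_subset) auto
qed (use assms in \<open>auto simp: hump_def\<close>)

text \<open>
  The ends are the zeros nearest to the given point; they exist because the zero set is compact.
\<close>

lemma hump_around:
  fixes u :: "real \<Rightarrow> real"
  assumes "continuous_on {c..d} u" "u c = 0" "u d = 0" "x \<in> {c..d}" "u x \<noteq> 0"
  obtains \<alpha> \<beta> where "c \<le> \<alpha>" "\<alpha> < x" "x < \<beta>" "\<beta> \<le> d" "hump u \<alpha> \<beta>"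
proof -
  have compact_zeros: "compact {y \<in> {y1..y2}. u y = 0}" if "{y1..y2} \<subseteq> {c..d}" for y1 y2
  proof -
    have "closed {y \<in> {y1..y2}. u y = 0}"
      using continuous_closed_preimage_constant[OF continuous_on_subset[OF assms(1) that]] by simp
    moreover have "bounded {y \<in> {y1..y2}. u y = 0}"
      by (rule bounded_subset[of "{y1..y2}"]) auto
    ultimately show ?thesis by (simp add: compact_eq_bounded_closed)
  qed
  obtain \<alpha> where \<alpha>: "\<alpha> \<in> {c..x}" "u \<alpha> = 0" "\<And>y. y \<in> {c..x} \<Longrightarrow> u y = 0 \<Longrightarrow> y \<le> \<alpha>"
    using compact_attains_sup[OF compact_zeros[of c x]] assms(2,4) by fastforce
  obtain \<beta> where \<beta>: "\<beta> \<in> {x..d}" "u \<beta> = 0" "\<And>y. y \<in> {x..d} \<Longrightarrow> u y = 0 \<Longrightarrow> \<beta> \<le> y"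
    using compact_attains_inf[OF compact_zeros[of x d]] assms(3,4) by fastforce
  have ne: "\<alpha> \<noteq> x" "\<beta> \<noteq> x" using \<alpha>(2) \<beta>(2) assms(5) by auto
  have "u y \<noteq> 0" if "y \<in> {\<alpha><..<\<beta>}" for y
    using \<alpha>(1) \<beta>(1) \<alpha>(3)[of y] \<beta>(3)[of y] that by (cases "y \<le> x") auto
  then have "hump u \<alpha> \<beta>" using \<alpha> \<beta> ne unfolding hump_def by auto
  then show thesis using that[of \<alpha> \<beta>] \<alpha> \<beta> ne by auto
qed

lemma hump_peak:
  assumes "hump u \<alpha> \<beta>" "C1_with_derivative_on {\<alpha>..\<beta>} u u'"
    and pos: "\<And>x. x \<in> {\<alpha><..<\<beta>} \<Longrightarrow> u x > 0"
  obtains c where "\<alpha> < c" "c < \<beta>" "u c > 0" "u' c = 0" "\<And>x. x \<in> {\<alpha>..\<beta>} \<Longrightarrow> u x \<le> u c"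
proof -
  have ab: "\<alpha> < \<beta>" "u \<alpha> = 0" "u \<beta> = 0" using assms(1) by (auto simp: hump_def)
  obtain c where c: "c \<in> {\<alpha>..\<beta>}" "\<And>x. x \<in> {\<alpha>..\<beta>} \<Longrightarrow> u x \<le> u c"
    using continuous_attains_sup[of "{\<alpha>..\<beta>}" u]
      C1_with_derivative_on_imp_continuous_on[OF assms(2)] ab by auto
  have "u c > 0"
    using c(2)[of "(\<alpha> + \<beta>) / 2"] pos[of "(\<alpha> + \<beta>) / 2"] ab by (auto simp: field_simps)
  then have "c \<noteq> \<alpha>" "c \<noteq> \<beta>" using ab by auto
  then have int: "\<alpha> < c" "c < \<beta>" using c(1) by auto
  have "(u has_real_derivative u' c) (at c within {\<alpha>..\<beta>})"
    using assms(2) c(1) unfolding C1_with_derivative_on_def by blast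
  then have "DERIV u c :> u' c" using int by (simp add: at_within_Icc_at)
  then have "u' c = 0"
    by (rule DERIV_local_max[of _ _ _ "min (c - \<alpha>) (\<beta> - c)"])
      (use int in \<open>auto intro!: c(2) simp: abs_if split: if_splits\<close>)
  then show thesis using that int \<open>u c > 0\<close> c(2) by blast
qed

section \<open>Existence of a hump with a flex\<close>

text \<open>
  As \<open>v'\<close> has constant sign, \<open>v\<close> is strictly monotone; it vanishes at the peak and is positive
  somewhere on the rising side, so it must decrease.
\<close>

lemma hump_without_flex_pos:
  assumes \<psi>: "\<And>s. \<psi> (- s) = - \<psi> s" "strict_mono \<psi>"
    and hump: "hump u \<alpha> \<beta>" and u: "C1_with_derivative_on {\<alpha>..\<beta>} u u'"
    and v: "C1_with_derivative_on {\<alpha>..\<beta>} (\<lambda>x. \<psi> (u' x)) v'"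
    and pos: "\<And>x. x \<in> {\<alpha><..<\<beta>} \<Longrightarrow> u x > 0"
    and nz: "\<And>x. x \<in> {\<alpha>..\<beta>} \<Longrightarrow> v' x \<noteq> 0"
  shows "\<And>x. x \<in> {\<alpha>..\<beta>} \<Longrightarrow> v' x < 0" "u' \<alpha> > 0" "u' \<beta> < 0"
proof -
  note \<psi>_sign = odd_strict_mono_zero_and_sign[of \<psi>, OF \<psi>]
  have u0: "u \<alpha> = 0" using hump by (simp add: hump_def)
  obtain c where c: "\<alpha> < c" "c < \<beta>" "u c > 0" "u' c = 0"
    using hump_peak[OF hump u pos] by blast
  obtain \<eta> where \<eta>: "\<alpha> < \<eta>" "\<eta> < c" "u c - u \<alpha> = u' \<eta> * (c - \<alpha>)"
    using C1_with_derivative_on_mvt[OF u, of \<alpha> c] c by auto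
  then have "u' \<eta> > 0" using u0 c by (simp add: zero_less_mult_iff)
  obtain \<zeta> where \<zeta>: "\<eta> < \<zeta>" "\<zeta> < c" "\<psi> (u' c) - \<psi> (u' \<eta>) = v' \<zeta> * (c - \<eta>)"
    using C1_with_derivative_on_mvt[OF v, of \<eta> c] c \<eta> by auto
  have "v' \<zeta> * (c - \<eta>) < 0"
    using \<zeta>(3) \<open>u' \<eta> > 0\<close> c(4) \<psi>_sign by (metis diff_0 neg_less_0_iff_less)
  then have v\<zeta>: "v' \<zeta> < 0" using \<eta> by (simp add: mult_less_0_iff)
  show neg: "v' x < 0" if "x \<in> {\<alpha>..\<beta>}" for x
    using nonzero_imp_same_sign[of "{\<alpha>..\<beta>}" v' x \<zeta>] v\<zeta> v nz that \<zeta> \<eta> c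
    unfolding C1_with_derivative_on_def by (auto simp: zero_less_mult_iff)
  obtain \<mu> where \<mu>: "\<alpha> < \<mu>" "\<mu> < c" "\<psi> (u' c) - \<psi> (u' \<alpha>) = v' \<mu> * (c - \<alpha>)"
    using C1_with_derivative_on_mvt[OF v, of \<alpha> c] c by auto
  have "v' \<mu> * (c - \<alpha>) < 0" using neg[of \<mu>] \<mu> c by (simp add: mult_less_0_iff)
  then show "u' \<alpha> > 0" using \<mu>(3) c(4) \<psi>_sign(1) \<psi>_sign(2)[of "u' \<alpha>"] by simp
  obtain \<nu> where \<nu>: "c < \<nu>" "\<nu> < \<beta>" "\<psi> (u' \<beta>) - \<psi> (u' c) = v' \<nu> * (\<beta> - c)"
    using C1_with_derivative_on_mvt[OF v, of c \<beta>] c by auto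
  have "v' \<nu> * (\<beta> - c) < 0" using neg[of \<nu>] \<nu> c by (simp add: mult_less_0_iff)
  then show "u' \<beta> < 0" using \<nu>(3) c(4) \<psi>_sign(1) \<psi>_sign(3)[of "u' \<beta>"] by simp
qed

lemma hump_without_flex:
  assumes \<psi>: "\<And>s. \<psi> (- s) = - \<psi> s" "strict_mono \<psi>"
    and hump: "hump u \<alpha> \<beta>" and u: "C1_with_derivative_on {\<alpha>..\<beta>} u u'"
    and v: "C1_with_derivative_on {\<alpha>..\<beta>} (\<lambda>x. \<psi> (u' x)) v'"
    and nz: "\<And>x. x \<in> {\<alpha>..\<beta>} \<Longrightarrow> v' x \<noteq> 0" and x: "x \<in> {\<alpha><..<\<beta>}"
  shows "\<And>y. y \<in> {\<alpha>..\<beta>} \<Longrightarrow> u x * v' y < 0" "u x * u' \<alpha> > 0" "u x * u' \<beta> < 0"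
proof -
  have same: "u x * u y > 0" if "y \<in> {\<alpha><..<\<beta>}" for y
    using hump_same_sign[OF hump C1_with_derivative_on_imp_continuous_on[OF u] x that] .
  have "(\<forall>y\<in>{\<alpha>..\<beta>}. u x * v' y < 0) \<and> u x * u' \<alpha> > 0 \<and> u x * u' \<beta> < 0"
  proof (cases "u x > 0")
    case True
    then have "\<And>y. y \<in> {\<alpha><..<\<beta>} \<Longrightarrow> u y > 0" using same zero_less_mult_pos by blast
    from hump_without_flex_pos[OF \<psi> hump u v this nz] True show ?thesis
      by (auto simp: mult_pos_neg)
  next
    case False
    then have neg: "u x < 0" using hump x by (auto simp: hump_def not_less less_eq_real_def)
    then have pos: "\<And>y. y \<in> {\<alpha><..<\<beta>} \<Longrightarrow> - u y > 0"
      using same by (auto simp: zero_less_mult_iff)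
    have v: "C1_with_derivative_on {\<alpha>..\<beta>} (\<lambda>x. \<psi> (- u' x)) (\<lambda>x. - v' x)"
      using C1_with_derivative_on_uminus[OF v] by (simp add: \<psi>)
    from hump_without_flex_pos[OF \<psi> hump_uminus[OF hump] C1_with_derivative_on_uminus[OF u] v pos]
      nz neg show ?thesis by (force simp: mult_neg_pos mult_neg_neg)
  qed
  then show "\<And>y. y \<in> {\<alpha>..\<beta>} \<Longrightarrow> u x * v' y < 0" "u x * u' \<alpha> > 0" "u x * u' \<beta> < 0"
    by blast+
qed

text \<open>
  Two humps of opposite sign with a common end cannot both be free of flexes, since \<open>v'\<close> would have
  a definite and opposite sign at that end. A hump without flex has such a neighbour at each of its
  ends that is interior to \<open>[c,d]\<close>, and the intermediate zero \<open>p\<close> guarantees one interior end.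
\<close>

lemma hump_with_flex_exists:
  assumes \<psi>: "\<And>s. \<psi> (- s) = - \<psi> s" "strict_mono \<psi>"
    and u: "C1_with_derivative_on {c..d} u u'"
    and v: "C1_with_derivative_on {c..d} (\<lambda>x. \<psi> (u' x)) v'"
    and zeros: "u c = 0" "u p = 0" "u d = 0" "c < p" "p < d"
    and nontriv: "nontrivial_on {c..d} u"
  obtains \<alpha> \<beta> \<xi> where "c \<le> \<alpha>" "\<beta> \<le> d" "hump u \<alpha> \<beta>" "\<xi> \<in> {\<alpha>..\<beta>}" "v' \<xi> = 0"
proof (rule ccontr)
  assume "\<not> thesis"
  then have none: "v' \<xi> \<noteq> 0" if "c \<le> \<alpha>" "\<beta> \<le> d" "hump u \<alpha> \<beta>" "\<xi> \<in> {\<alpha>..\<beta>}" for \<alpha> \<beta> \<xi>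
    using that \<open>\<And>\<xi> \<beta> \<alpha>. c \<le> \<alpha> \<Longrightarrow> \<beta> \<le> d \<Longrightarrow> hump u \<alpha> \<beta> \<Longrightarrow> \<xi> \<in> {\<alpha>..\<beta>} \<Longrightarrow> v' \<xi> = 0 \<Longrightarrow> thesis\<close>
    by blast
  have cont: "continuous_on {c..d} u"
    using u by (rule C1_with_derivative_on_imp_continuous_on)
  have no_flex:
    "u x * v' y < 0" "u x * u' \<alpha> > 0" "u x * u' \<beta> < 0"
    if "c \<le> \<alpha>" "\<beta> \<le> d" "hump u \<alpha> \<beta>" "x \<in> {\<alpha><..<\<beta>}" "y \<in> {\<alpha>..\<beta>}" for \<alpha> \<beta> x y
  proof -
    have "{\<alpha>..\<beta>} \<subseteq> {c..d}" using that by auto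
    note hump_without_flex[OF \<psi> that(3) C1_with_derivative_on_subset[OF u this]
        C1_with_derivative_on_subset[OF v this] none[OF that(1-3)] that(4)]
    then show "u x * v' y < 0" "u x * u' \<alpha> > 0" "u x * u' \<beta> < 0" using that(5) by auto
  qed
  obtain x where x: "x \<in> {c..d}" "u x \<noteq> 0" using nontriv by (auto simp: nontrivial_on_def)
  obtain \<alpha> \<beta> where \<alpha>\<beta>: "c \<le> \<alpha>" "\<alpha> < x" "x < \<beta>" "\<beta> \<le> d" "hump u \<alpha> \<beta>"
    using hump_around[OF cont zeros(1,3) x] by blast
  have ends: "u \<alpha> = 0" "u \<beta> = 0" using \<alpha>\<beta>(5) by (auto simp: hump_def)
  have deriv: "((\<lambda>z. u x * u z) has_real_derivative u x * u' y) (at y within {c..d})"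
    if "y \<in> {c..d}" for y
    using u that unfolding C1_with_derivative_on_def by (auto intro: DERIV_cmult)
  have "p \<notin> {\<alpha><..<\<beta>}" using zeros(2) \<alpha>\<beta>(5) by (auto simp: hump_def)
  then consider "\<beta> < d" | "c < \<alpha>" using zeros(4,5) by fastforce
  then show False
  proof cases
    case 1
    have "u x * u' \<beta> < 0" using no_flex(3)[OF \<alpha>\<beta>(1,4,5), of x x] \<alpha>\<beta> by auto
    from has_real_derivative_neg_dec_right[OF deriv this] \<alpha>\<beta>
    obtain e where e: "e > 0" "\<And>h. 0 < h \<Longrightarrow> \<beta> + h \<in> {c..d} \<Longrightarrow> h < e \<Longrightarrow> u x * u (\<beta> + h) < 0"
      using ends by auto
    define y where "y = \<beta> + min (e / 2) (d - \<beta>)"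
    have e': "u x * u z < 0" if "\<beta> < z" "z \<le> y" for z
      using e(2)[of "z - \<beta>"] that e(1) 1 \<alpha>\<beta> unfolding y_def by auto
    have y: "y \<in> {c..d}" "\<beta> < y" using e(1) 1 \<alpha>\<beta> unfolding y_def by auto
    have uy: "u x * u y < 0" using e' y by simp
    then have "u y \<noteq> 0" by auto
    then obtain \<alpha>' \<beta>' where \<alpha>\<beta>': "c \<le> \<alpha>'" "\<alpha>' < y" "y < \<beta>'" "\<beta>' \<le> d" "hump u \<alpha>' \<beta>'"
      using hump_around[OF cont zeros(1,3) y(1)] by blast
    have "\<alpha>' \<le> \<beta>" using e'[of \<alpha>'] \<alpha>\<beta>' by (force simp: hump_def)
    moreover have "\<beta> \<le> \<alpha>'" using ends \<alpha>\<beta>' y by (force simp: hump_def)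
    ultimately have "\<alpha>' = \<beta>" by simp
    then have "u y * v' \<beta> < 0" using no_flex(1)[OF \<alpha>\<beta>'(1,4,5), of y \<beta>] \<alpha>\<beta>' by auto
    moreover have "u x * v' \<beta> < 0" using no_flex(1)[OF \<alpha>\<beta>(1,4,5), of x \<beta>] \<alpha>\<beta> by auto
    ultimately show False using uy by (auto simp: mult_less_0_iff)
  next
    case 2
    have "u x * u' \<alpha> > 0" using no_flex(2)[OF \<alpha>\<beta>(1,4,5), of x x] \<alpha>\<beta> by auto
    from has_real_derivative_pos_inc_left[OF deriv this] \<alpha>\<beta>
    obtain e where e: "e > 0" "\<And>h. 0 < h \<Longrightarrow> \<alpha> - h \<in> {c..d} \<Longrightarrow> h < e \<Longrightarrow> u x * u (\<alpha> - h) < 0"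
      using ends by auto
    define y where "y = \<alpha> - min (e / 2) (\<alpha> - c)"
    have e': "u x * u z < 0" if "z < \<alpha>" "y \<le> z" for z
      using e(2)[of "\<alpha> - z"] that e(1) 2 \<alpha>\<beta> unfolding y_def by auto
    have y: "y \<in> {c..d}" "y < \<alpha>" using e(1) 2 \<alpha>\<beta> unfolding y_def by auto
    have uy: "u x * u y < 0" using e' y by simp
    then have "u y \<noteq> 0" by auto
    then obtain \<alpha>' \<beta>' where \<alpha>\<beta>': "c \<le> \<alpha>'" "\<alpha>' < y" "y < \<beta>'" "\<beta>' \<le> d" "hump u \<alpha>' \<beta>'"
      using hump_around[OF cont zeros(1,3) y(1)] by blast
    have "\<alpha> \<le> \<beta>'" using e'[of \<beta>'] \<alpha>\<beta>' by (force simp: hump_def)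
    moreover have "\<beta>' \<le> \<alpha>" using ends \<alpha>\<beta>' y by (force simp: hump_def)
    ultimately have "\<beta>' = \<alpha>" by simp
    then have "u y * v' \<alpha> < 0" using no_flex(1)[OF \<alpha>\<beta>'(1,4,5), of y \<alpha>] \<alpha>\<beta>' by auto
    moreover have "u x * v' \<alpha> < 0" using no_flex(1)[OF \<alpha>\<beta>(1,4,5), of x \<alpha>] \<alpha>\<beta> by auto
    ultimately show False using uy by (auto simp: mult_less_0_iff)
  qed
qed

section \<open>The inequality on one hump\<close>

text \<open>
  Truncating \<open>g'\<close> to its positive part, as \<open>ennreal\<close> does, can only increase the integral.
\<close>

lemma increment_le_nn_integral:
  assumes "C1_with_derivative_on {c..d} g g'" "c \<le> d"
  shows "ennreal (g d - g c) \<le> (\<integral>\<^sup>+x\<in>{c..d}. ennreal (g' x) \<partial>lborel)"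
proof -
  define h where "h x = indicator {c..d} x * g' x" for x
  have "has_bochner_integral lborel (\<lambda>x. indicator {c..d} x *\<^sub>R g' x) (g d - g c)"
    by (rule has_bochner_integral_FTC_Icc[OF assms(2)])
      (use assms(1) in \<open>auto simp: C1_with_derivative_on_def
          has_real_derivative_iff_has_vector_derivative\<close>)
  then have h: "integrable lborel h" "integral\<^sup>L lborel h = g d - g c"
    unfolding h_def by (auto simp: has_bochner_integral_iff)
  have "g d - g c \<le> enn2real (\<integral>\<^sup>+x. ennreal (h x) \<partial>lborel)"
    using real_lebesgue_integral_def[OF h(1)] h(2) enn2real_nonneg by smt
  moreover have "(\<integral>\<^sup>+x. ennreal (h x) \<partial>lborel) < top"
  proof -
    have "(\<integral>\<^sup>+x. ennreal (h x) \<partial>lborel) \<le> (\<integral>\<^sup>+x. ennreal (norm (h x)) \<partial>lborel)"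
      by (intro nn_integral_mono ennreal_leI) auto
    also have "\<dots> < top" using h(1) by (simp add: integrable_iff_bounded)
    finally show ?thesis .
  qed
  ultimately have "ennreal (g d - g c) \<le> (\<integral>\<^sup>+x. ennreal (h x) \<partial>lborel)"
    by (metis ennreal_enn2real ennreal_leI)
  also have "\<dots> = (\<integral>\<^sup>+x\<in>{c..d}. ennreal (g' x) \<partial>lborel)"
    unfolding h_def by (intro nn_integral_cong) (auto simp: indicator_def)
  finally show ?thesis .
qed

text \<open>
  The weighted integral skips the zeros of \<open>u\<close>; the increment is still dominated by it as long as
  \<open>g\<close> does not grow there.
\<close>

lemma increment_le_weighted_integral:
  assumes "C1_with_derivative_on {c..d} g g'" "c \<le> d" "{c..d} \<subseteq> {r..s}"
    and "\<And>x. x \<in> {c..d} \<Longrightarrow> u x = 0 \<Longrightarrow> g' x \<le> 0"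
    and "\<And>x. x \<in> {c..d} \<Longrightarrow> u x \<noteq> 0 \<Longrightarrow> g' x \<le> p x * Phi \<psi>1 \<psi>2 f (u x)"
  shows "ennreal (g d - g c) \<le> weighted_integral \<psi>1 \<psi>2 f p u r s"
proof -
  have "(\<integral>\<^sup>+x\<in>{c..d}. ennreal (g' x) \<partial>lborel) \<le> weighted_integral \<psi>1 \<psi>2 f p u r s"
    unfolding weighted_integral_def
  proof (rule nn_integral_mono)
    fix x
    show "ennreal (g' x) * indicator {c..d} x
      \<le> ennreal (p x * Phi \<psi>1 \<psi>2 f (u x)) * indicator {x \<in> {r..s}. u x \<noteq> 0} x"
      using assms(3) assms(4)[of x] assms(5)[of x]
      by (cases "x \<in> {c..d}"; cases "u x = 0")
        (auto simp: indicator_def ennreal_neg intro!: ennreal_leI)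
  qed
  with increment_le_nn_integral[OF assms(1,2)] show ?thesis by (rule order_trans)
qed

text \<open>
  The bound on \<open>- v'\<close> limits how fast \<open>u\<close> can climb from \<open>0\<close> to its maximum: the shorter side of the
  peak has length at most \<open>L/2\<close>, and \<open>K\<close> is chosen so that \<open>K (L/2) \<psi>\<^sub>1(L/2) = 1\<close>, which is exactly
  the borderline value. Strictness comes from the mean value theorem, whose intermediate point is
  strictly closer to the peak than the end of the hump is.
\<close>

lemma hump_inequality_pos:
  assumes \<psi>1: "\<And>s. \<psi>1 (- s) = - \<psi>1 s" "strict_mono \<psi>1"
    and \<psi>2: "\<And>s. \<psi>2 (- s) = - \<psi>2 s" "strict_mono \<psi>2"
    and sub: "\<And>x y. x \<ge> 0 \<Longrightarrow> y \<ge> 0 \<Longrightarrow> \<psi>1 (x * y) \<le> \<psi>1 x * \<psi>1 y"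
    and super: "\<And>x y. x \<ge> 0 \<Longrightarrow> y \<ge> 0 \<Longrightarrow> \<psi>2 (x * y) \<ge> \<psi>2 x * \<psi>2 y"
    and f: "\<And>s. f (- s) = - f s" "\<And>s. s \<noteq> 0 \<Longrightarrow> s * f s > 0"
    and sol: "solves_on {\<alpha>..\<beta>} \<psi>1 \<psi>2 q f u u' v' w'"
    and hump: "hump u \<alpha> \<beta>" and pos: "\<And>x. x \<in> {\<alpha><..<\<beta>} \<Longrightarrow> u x > 0"
    and \<xi>: "\<xi> \<in> {\<alpha>..\<beta>}" "v' \<xi> = 0" and L: "\<beta> - \<alpha> \<le> L"
  shows "ennreal (\<psi>2 ((2 / L) / \<psi>1 (L / 2)))
    < weighted_integral \<psi>1 \<psi>2 f (neg_part q) u \<alpha> \<xi> + weighted_integral \<psi>1 \<psi>2 f (pos_part q) u \<xi> \<beta>"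
proof (rule ccontr)
  note \<psi>1_sign = odd_strict_mono_zero_and_sign[of \<psi>1, OF \<psi>1]
    and \<psi>2_sign = odd_strict_mono_zero_and_sign[of \<psi>2, OF \<psi>2]
  have u: "C1_with_derivative_on {\<alpha>..\<beta>} u u'"
    and v: "C1_with_derivative_on {\<alpha>..\<beta>} (\<lambda>x. \<psi>1 (u' x)) v'"
    and w: "C1_with_derivative_on {\<alpha>..\<beta>} (\<lambda>x. \<psi>2 (v' x)) w'"
    and eq: "\<And>x. x \<in> {\<alpha>..\<beta>} \<Longrightarrow> w' x = - (q x * f (u x))"
    using sol unfolding solves_on_def by (auto simp: eq_neg_iff_add_eq_0)
  have ends: "\<alpha> < \<beta>" "u \<alpha> = 0" "u \<beta> = 0" using hump by (auto simp: hump_def)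
  have nonneg: "u x \<ge> 0" if "x \<in> {\<alpha>..\<beta>}" for x
    using pos[of x] that ends by (cases "x = \<alpha>"; cases "x = \<beta>") auto
  obtain c where c: "\<alpha> < c" "c < \<beta>" "u c > 0" "u' c = 0" "\<And>x. x \<in> {\<alpha>..\<beta>} \<Longrightarrow> u x \<le> u c"
    using hump_peak[OF hump u pos] by blast
  define m where "m = u c"
  define C where "C = \<psi>2 (\<psi>1 m)"
  define K where "K = (2 / L) / \<psi>1 (L / 2)"
  have m: "m > 0" "\<psi>1 m > 0" and C: "C > 0"
    using c(3) \<psi>1_sign \<psi>2_sign by (auto simp: m_def C_def)
  have L0: "L > 0" using L ends by simp
  then have \<psi>L: "\<psi>1 (L / 2) > 0" using \<psi>1_sign by simp
  then have K: "K > 0" "\<psi>2 K > 0" using L0 \<psi>2_sign by (auto simp: K_def)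
  have f0: "f 0 = 0" using f(1)[of 0] by simp
  \<comment> \<open>Dividing by \<open>C = \<psi>\<^sub>2(\<psi>\<^sub>1(m))\<close> instead of \<open>\<psi>\<^sub>2(\<psi>\<^sub>1(u))\<close> makes the quotient smaller. The claim is
    used with \<open>r = q\<close> to the right of the flex and with \<open>r = - q\<close> to the left.\<close>
  have weight: "r * f (u x) / C \<le> max r 0 * Phi \<psi>1 \<psi>2 f (u x)" if "x \<in> {\<alpha>..\<beta>}" "u x \<noteq> 0" for r x
  proof -
    have ux: "u x > 0" "u x \<le> m" using nonneg[OF that(1)] that(2) c(5)[OF that(1)] by (auto simp: m_def)
    then have fu: "f (u x) > 0" using f(2)[of "u x"] by (simp add: zero_less_mult_iff)
    have "\<psi>2 (\<psi>1 (u x)) > 0" "\<psi>2 (\<psi>1 (u x)) \<le> C"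
      using ux \<psi>1_sign \<psi>2_sign \<psi>1(2) \<psi>2(2) by (auto simp: C_def strict_mono_less_eq)
    then have "f (u x) / C \<le> Phi \<psi>1 \<psi>2 f (u x)"
      using fu unfolding Phi_def by (intro divide_left_mono) auto
    moreover have "f (u x) / C > 0" using fu C by simp
    ultimately have "r * (f (u x) / C) \<le> max r 0 * Phi \<psi>1 \<psi>2 f (u x)"
      by (intro mult_mono) auto
    then show ?thesis by simp
  qed
  assume "\<not> ?thesis"
  then have M: "weighted_integral \<psi>1 \<psi>2 f (neg_part q) u \<alpha> \<xi>
      + weighted_integral \<psi>1 \<psi>2 f (pos_part q) u \<xi> \<beta> \<le> ennreal (\<psi>2 K)"
    by (simp add: K_def)
  have slope: "- v' x \<le> K * \<psi>1 m" if x: "x \<in> {\<alpha>..\<beta>}" for x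
  proof -
    have "ennreal (- \<psi>2 (v' x) / C) \<le> ennreal (\<psi>2 K)"
    proof (cases "\<xi> \<le> x")
      case True
      have sub: "{\<xi>..x} \<subseteq> {\<alpha>..\<beta>}" using \<xi> x by auto
      have "ennreal ((- 1 / C) * \<psi>2 (v' x) - (- 1 / C) * \<psi>2 (v' \<xi>))
          \<le> weighted_integral \<psi>1 \<psi>2 f (pos_part q) u \<xi> \<beta>"
      proof (rule increment_le_weighted_integral[where g = "\<lambda>x. (- 1 / C) * \<psi>2 (v' x)"
            and g' = "\<lambda>x. (- 1 / C) * w' x"])
        show "C1_with_derivative_on {\<xi>..x} (\<lambda>x. (- 1 / C) * \<psi>2 (v' x)) (\<lambda>x. (- 1 / C) * w' x)"
          using C1_with_derivative_on_cmult[OF C1_with_derivative_on_subset[OF w sub]] .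
        fix y assume y: "y \<in> {\<xi>..x}"
        then have y': "y \<in> {\<alpha>..\<beta>}" using sub by auto
        show "(- 1 / C) * w' y \<le> 0" if "u y = 0" using eq[OF y'] that f0 by simp
        show "(- 1 / C) * w' y \<le> pos_part q y * Phi \<psi>1 \<psi>2 f (u y)" if "u y \<noteq> 0"
          using weight[OF y' that, of "q y"] eq[OF y'] by (simp add: pos_part_def)
      qed (use True x in auto)
      then have "ennreal (- \<psi>2 (v' x) / C) \<le> weighted_integral \<psi>1 \<psi>2 f (pos_part q) u \<xi> \<beta>"
        using \<xi>(2) \<psi>2_sign(1) by simp
      also have "\<dots> \<le> ennreal (\<psi>2 K)" by (rule order_trans[OF _ M]) simp
      finally show ?thesis .
    next
      case False
      have sub: "{x..\<xi>} \<subseteq> {\<alpha>..\<beta>}" using \<xi> x by auto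
      have "ennreal ((1 / C) * \<psi>2 (v' \<xi>) - (1 / C) * \<psi>2 (v' x))
          \<le> weighted_integral \<psi>1 \<psi>2 f (neg_part q) u \<alpha> \<xi>"
      proof (rule increment_le_weighted_integral[where g = "\<lambda>x. (1 / C) * \<psi>2 (v' x)"
            and g' = "\<lambda>x. (1 / C) * w' x"])
        show "C1_with_derivative_on {x..\<xi>} (\<lambda>x. (1 / C) * \<psi>2 (v' x)) (\<lambda>x. (1 / C) * w' x)"
          using C1_with_derivative_on_cmult[OF C1_with_derivative_on_subset[OF w sub]] .
        fix y assume y: "y \<in> {x..\<xi>}"
        then have y': "y \<in> {\<alpha>..\<beta>}" using sub by auto
        show "(1 / C) * w' y \<le> 0" if "u y = 0" using eq[OF y'] that f0 by simp
        show "(1 / C) * w' y \<le> neg_part q y * Phi \<psi>1 \<psi>2 f (u y)" if "u y \<noteq> 0"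
          using weight[OF y' that, of "- q y"] eq[OF y'] by (simp add: neg_part_def)
      qed (use False x in auto)
      then have "ennreal (- \<psi>2 (v' x) / C) \<le> weighted_integral \<psi>1 \<psi>2 f (neg_part q) u \<alpha> \<xi>"
        using \<xi>(2) \<psi>2_sign(1) by simp
      also have "\<dots> \<le> ennreal (\<psi>2 K)" by (rule order_trans[OF _ M]) simp
      finally show ?thesis .
    qed
    then have "\<psi>2 (- v' x) / C \<le> \<psi>2 K" using K by (simp add: \<psi>2(1))
    then have "\<psi>2 (- v' x) \<le> \<psi>2 K * \<psi>2 (\<psi>1 m)" using C by (simp add: field_simps C_def)
    also have "\<dots> \<le> \<psi>2 (K * \<psi>1 m)" using super K m by simp
    finally show ?thesis using \<psi>2(2) by (simp add: strict_mono_less_eq)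
  qed
  \<comment> \<open>\<open>m / d\<close> is the mean slope of \<open>u\<close> on a side of the peak that has length \<open>d\<close>.\<close>
  have too_steep: False if d: "0 < d" "d \<le> L / 2" and steep: "\<psi>1 (m / d) < d * (K * \<psi>1 m)" for d
  proof -
    have "\<psi>1 d > 0" "\<psi>1 d \<le> \<psi>1 (L / 2)" using d \<psi>1_sign \<psi>1(2) by (auto simp: strict_mono_less_eq)
    have "\<psi>1 m = \<psi>1 (m / d * d)" using d by simp
    also have "\<dots> \<le> \<psi>1 (m / d) * \<psi>1 d" using sub[of "m / d" d] d m by simp
    also have "\<dots> < d * (K * \<psi>1 m) * \<psi>1 d" using steep \<open>\<psi>1 d > 0\<close> by simp
    also have "\<dots> = (d * \<psi>1 d) * (K * \<psi>1 m)" by simp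
    also have "\<dots> \<le> (L / 2 * \<psi>1 (L / 2)) * (K * \<psi>1 m)"
      using d \<open>\<psi>1 d > 0\<close> \<open>\<psi>1 d \<le> \<psi>1 (L / 2)\<close> K m by (intro mult_right_mono mult_mono) auto
    also have "\<dots> = \<psi>1 m" using L0 \<psi>L by (simp add: K_def field_simps)
    finally show False by simp
  qed
  have K\<psi>: "K * \<psi>1 m > 0" using K m by simp
  consider "c - \<alpha> \<le> L / 2" | "\<beta> - c \<le> L / 2" using L by linarith
  then show False
  proof cases
    case 1
    obtain \<eta> where \<eta>: "\<alpha> < \<eta>" "\<eta> < c" "u c - u \<alpha> = u' \<eta> * (c - \<alpha>)"
      using C1_with_derivative_on_mvt[OF u, of \<alpha> c] c by auto
    obtain \<zeta> where \<zeta>: "\<eta> < \<zeta>" "\<zeta> < c" "\<psi>1 (u' c) - \<psi>1 (u' \<eta>) = v' \<zeta> * (c - \<eta>)"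
      using C1_with_derivative_on_mvt[OF v, of \<eta> c] c \<eta> by auto
    have "\<psi>1 (m / (c - \<alpha>)) = \<psi>1 (u' \<eta>)" using \<eta> ends c by (simp add: m_def)
    also have "\<dots> = (c - \<eta>) * - v' \<zeta>" using \<zeta>(3) c(4) \<psi>1_sign(1) by (simp add: algebra_simps)
    also have "\<dots> \<le> (c - \<eta>) * (K * \<psi>1 m)" using slope[of \<zeta>] \<zeta> \<eta> c by (intro mult_left_mono) auto
    also have "\<dots> < (c - \<alpha>) * (K * \<psi>1 m)" using \<eta> K\<psi> by (intro mult_strict_right_mono) auto
    finally show False using too_steep[of "c - \<alpha>"] 1 c by simp
  next
    case 2
    obtain \<eta> where \<eta>: "c < \<eta>" "\<eta> < \<beta>" "u \<beta> - u c = u' \<eta> * (\<beta> - c)"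
      using C1_with_derivative_on_mvt[OF u, of c \<beta>] c by auto
    obtain \<zeta> where \<zeta>: "c < \<zeta>" "\<zeta> < \<eta>" "\<psi>1 (u' \<eta>) - \<psi>1 (u' c) = v' \<zeta> * (\<eta> - c)"
      using C1_with_derivative_on_mvt[OF v, of c \<eta>] c \<eta> by auto
    have "m / (\<beta> - c) = - u' \<eta>" using \<eta> ends c by (simp add: m_def field_simps)
    then have "\<psi>1 (m / (\<beta> - c)) = - \<psi>1 (u' \<eta>)" by (simp add: \<psi>1(1))
    also have "\<dots> = (\<eta> - c) * - v' \<zeta>" using \<zeta>(3) c(4) \<psi>1_sign(1) by (simp add: algebra_simps)
    also have "\<dots> \<le> (\<eta> - c) * (K * \<psi>1 m)" using slope[of \<zeta>] \<zeta> \<eta> c by (intro mult_left_mono) auto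
    also have "\<dots> < (\<beta> - c) * (K * \<psi>1 m)" using \<eta> K\<psi> by (intro mult_strict_right_mono) auto
    finally show False using too_steep[of "\<beta> - c"] 2 c by simp
  qed
qed

lemma weighted_integral_uminus:
  assumes "\<And>s. \<psi>1 (- s) = - \<psi>1 s" "\<And>s. \<psi>2 (- s) = - \<psi>2 s" "\<And>s. f (- s) = - f s"
  shows "weighted_integral \<psi>1 \<psi>2 f p (\<lambda>x. - u x) c d = weighted_integral \<psi>1 \<psi>2 f p u c d"
  unfolding weighted_integral_def Phi_def assms by simp

text \<open>
  A negative hump is a positive hump of \<open>- u\<close>, which solves the same equation and has the same
  \<open>\<Phi>\<close>-weights because all the nonlinearities are odd.
\<close>

lemma hump_inequality:
  assumes \<psi>1: "\<And>s. \<psi>1 (- s) = - \<psi>1 s" "strict_mono \<psi>1"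
    and \<psi>2: "\<And>s. \<psi>2 (- s) = - \<psi>2 s" "strict_mono \<psi>2"
    and sub: "\<And>x y. x \<ge> 0 \<Longrightarrow> y \<ge> 0 \<Longrightarrow> \<psi>1 (x * y) \<le> \<psi>1 x * \<psi>1 y"
    and super: "\<And>x y. x \<ge> 0 \<Longrightarrow> y \<ge> 0 \<Longrightarrow> \<psi>2 (x * y) \<ge> \<psi>2 x * \<psi>2 y"
    and f: "\<And>s. f (- s) = - f s" "\<And>s. s \<noteq> 0 \<Longrightarrow> s * f s > 0"
    and sol: "solves_on {\<alpha>..\<beta>} \<psi>1 \<psi>2 q f u u' v' w'"
    and hump: "hump u \<alpha> \<beta>" and \<xi>: "\<xi> \<in> {\<alpha>..\<beta>}" "v' \<xi> = 0" and L: "\<beta> - \<alpha> \<le> L"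
  shows "ennreal (\<psi>2 ((2 / L) / \<psi>1 (L / 2)))
    < weighted_integral \<psi>1 \<psi>2 f (neg_part q) u \<alpha> \<xi> + weighted_integral \<psi>1 \<psi>2 f (pos_part q) u \<xi> \<beta>"
proof -
  define x where "x = (\<alpha> + \<beta>) / 2"
  have x: "x \<in> {\<alpha><..<\<beta>}" using hump by (auto simp: hump_def x_def)
  have "continuous_on {\<alpha>..\<beta>} u"
    using sol unfolding solves_on_def by (blast intro: C1_with_derivative_on_imp_continuous_on)
  then have same: "u x * u y > 0" if "y \<in> {\<alpha><..<\<beta>}" for y
    using hump_same_sign[OF hump] x that by blast
  show ?thesis
  proof (cases "u x > 0")
    case True
    then have "\<And>y. y \<in> {\<alpha><..<\<beta>} \<Longrightarrow> u y > 0" using same zero_less_mult_pos by blast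
    from hump_inequality_pos[OF \<psi>1 \<psi>2 sub super f sol hump this \<xi> L] show ?thesis .
  next
    case False
    then have "u x < 0" using hump x by (auto simp: hump_def not_less less_eq_real_def)
    then have "\<And>y. y \<in> {\<alpha><..<\<beta>} \<Longrightarrow> - u y > 0"
      using same by (auto simp: zero_less_mult_iff)
    from hump_inequality_pos[OF \<psi>1 \<psi>2 sub super f
        solves_on_uminus[OF \<psi>1(1) \<psi>2(1) f(1) sol] hump_uminus[OF hump] this \<xi>(1) _ L] \<xi>(2)
    show ?thesis by (simp add: weighted_integral_uminus \<psi>1(1) \<psi>2(1) f(1))
  qed
qed

lemma weighted_integral_mono:
  assumes "{c..d} \<subseteq> {r..s}"
  shows "weighted_integral \<psi>1 \<psi>2 f p u c d \<le> weighted_integral \<psi>1 \<psi>2 f p u r s"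
  unfolding weighted_integral_def
  by (intro nn_integral_mono) (use assms in \<open>auto simp: indicator_def\<close>)

section \<open>From one triple of zeros to the whole sequence\<close>

text \<open>
  The flex of a hump inside \<open>[c,d]\<close> is an admissible splitting point, and enlarging the domains of
  integration from the hump to \<open>[c,d]\<close> only increases the integrals.
\<close>

lemma three_zeros_inequality:
  assumes \<psi>1: "\<And>s. \<psi>1 (- s) = - \<psi>1 s" "strict_mono \<psi>1"
    and \<psi>2: "\<And>s. \<psi>2 (- s) = - \<psi>2 s" "strict_mono \<psi>2"
    and sub: "\<And>x y. x \<ge> 0 \<Longrightarrow> y \<ge> 0 \<Longrightarrow> \<psi>1 (x * y) \<le> \<psi>1 x * \<psi>1 y"
    and super: "\<And>x y. x \<ge> 0 \<Longrightarrow> y \<ge> 0 \<Longrightarrow> \<psi>2 (x * y) \<ge> \<psi>2 x * \<psi>2 y"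
    and f: "\<And>s. f (- s) = - f s" "\<And>s. s \<noteq> 0 \<Longrightarrow> s * f s > 0"
    and sol: "solves_on {c..d} \<psi>1 \<psi>2 q f u u' v' w'"
    and zeros: "u c = 0" "u p = 0" "u d = 0" "c < p" "p < d"
    and nontriv: "nontrivial_on {c..d} u" and L: "d - c \<le> L"
  shows "ennreal (\<psi>2 ((2 / L) / \<psi>1 (L / 2))) < max_split_integral \<psi>1 \<psi>2 q f u c d"
proof -
  obtain \<alpha> \<beta> \<xi> where h: "c \<le> \<alpha>" "\<beta> \<le> d" "hump u \<alpha> \<beta>" "\<xi> \<in> {\<alpha>..\<beta>}" "v' \<xi> = 0"
    using hump_with_flex_exists[OF \<psi>1 _ _ zeros nontriv, of u' v'] sol
    unfolding solves_on_def by blast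
  have "ennreal (\<psi>2 ((2 / L) / \<psi>1 (L / 2)))
    < weighted_integral \<psi>1 \<psi>2 f (neg_part q) u \<alpha> \<xi> + weighted_integral \<psi>1 \<psi>2 f (pos_part q) u \<xi> \<beta>"
    by (rule hump_inequality[OF \<psi>1 \<psi>2 sub super f solves_on_subset[OF sol] h(3-5)])
      (use h L in auto)
  also have "\<dots> \<le> weighted_integral \<psi>1 \<psi>2 f (neg_part q) u c \<xi>
      + weighted_integral \<psi>1 \<psi>2 f (pos_part q) u \<xi> d"
    using h by (intro add_mono weighted_integral_mono) auto
  also have "\<dots> \<le> max_split_integral \<psi>1 \<psi>2 q f u c d"
    unfolding max_split_integral_def by (rule SUP_upper) (use h in auto)
  finally show ?thesis .
qed

text \<open>
  Addition in \<open>ennreal\<close> is not strictly monotone at \<open>\<infinity>\<close>, so the case of an infinite summand is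
  separated and the finite case is carried out in the reals.
\<close>

lemma card_less_cmult_sum:
  fixes S :: "'i \<Rightarrow> ennreal"
  assumes "finite A" "A \<noteq> {}" "p > 0" "\<And>k. k \<in> A \<Longrightarrow> ennreal p < S k"
  shows "of_nat (card A) < ennreal (inverse p) * sum S A"
proof (cases "\<exists>k\<in>A. S k = top")
  case True
  then have "sum S A = top" using assms(1) by simp
  then show ?thesis using assms(3) by (simp add: ennreal_mult_top of_nat_less_top)
next
  case False
  define r where "r k = enn2real (S k)" for k
  have S: "S k = ennreal (r k)" if "k \<in> A" for k
    using False that by (simp add: r_def less_top)
  have r: "p < r k" if "k \<in> A" for k
    using assms(3) assms(4)[OF that] S[OF that] by (simp add: ennreal_less_iff)
  have "real (card A) * p < sum r A"
    using sum_strict_mono[OF assms(1,2), of "\<lambda>_. p" r] r by simp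
  then have "real (card A) < inverse p * sum r A" using assms(3) by (simp add: field_simps)
  then have "ennreal (real (card A)) < ennreal (inverse p * sum r A)"
    by (simp add: ennreal_lessI)
  also have "\<dots> = ennreal (inverse p) * ennreal (sum r A)"
    using assms(3) by (simp add: ennreal_mult')
  also have "ennreal (sum r A) = (\<Sum>k\<in>A. ennreal (r k))"
    by (rule sum_ennreal[symmetric]) (simp add: r_def)
  also have "\<dots> = sum S A" using S by (intro sum.cong) auto
  finally show ?thesis by (simp flip: ennreal_of_nat_eq_real_of_nat)
qed

theorem theorem2p4:
  fixes a b :: real
    and \<psi>1 \<psi>2 f q u :: "real \<Rightarrow> real"
    and N :: nat
    and t :: "nat \<Rightarrow> real"
  assumes "a < b"
    and psi1_odd: "\<And>s. \<psi>1 (- s) = - \<psi>1 s"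
    and psi1_incr: "strict_mono \<psi>1"
    and psi2_odd: "\<And>s. \<psi>2 (- s) = - \<psi>2 s"
    and psi2_incr: "strict_mono \<psi>2"
    and psi1_submult: "\<And>x y. x \<ge> 0 \<Longrightarrow> y \<ge> 0 \<Longrightarrow> \<psi>1 (x * y) \<le> \<psi>1 x * \<psi>1 y"
    and psi1_convex: "convex_on {0<..} (\<lambda>s. 1 / \<psi>1 s)"
    and psi2_supermult: "\<And>x y. x \<ge> 0 \<Longrightarrow> y \<ge> 0 \<Longrightarrow> \<psi>2 (x * y) \<ge> \<psi>2 x * \<psi>2 y"
    and q_cont: "continuous_on {a..b} q"
    and f_odd: "\<And>s. f (- s) = - f s"
    and f_cont: "continuous_on UNIV f"
    and f_sign: "\<And>s. s \<noteq> 0 \<Longrightarrow> s * f s > 0"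
    and sol: "is_solution a b \<psi>1 \<psi>2 q f u"
    and nontriv: "nontrivial_on {a..b} u"
    and "N \<ge> 1"
    and t_incr: "strict_mono_on {1..2 * N + 1} t"
    and t_range: "\<And>k. k \<in> {1..2 * N + 1} \<Longrightarrow> t k \<in> {a..b}"
    and t_zero: "\<And>k. k \<in> {1..2 * N + 1} \<Longrightarrow> u (t k) = 0"
    and nontriv_sub: "\<And>k. k \<in> {1..N} \<Longrightarrow> nontrivial_on {t (2 * k - 1)..t (2 * k + 1)} u"
  shows "of_nat N <
      ennreal (inverse (\<psi>2 ((2 / (b - a)) / \<psi>1 ((b - a) / 2)))) *
      (\<Sum>k = 1..N. max_split_integral \<psi>1 \<psi>2 q f u (t (2 * k - 1)) (t (2 * k + 1)))"
proof -
  obtain u' v' w' where uvw: "solves_on {a..b} \<psi>1 \<psi>2 q f u u' v' w'"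
    using sol unfolding is_solution_def solves_on_def by blast
  have "ennreal (\<psi>2 ((2 / (b - a)) / \<psi>1 ((b - a) / 2)))
      < max_split_integral \<psi>1 \<psi>2 q f u (t (2 * k - 1)) (t (2 * k + 1))" if k: "k \<in> {1..N}" for k
  proof (rule three_zeros_inequality[OF psi1_odd psi1_incr psi2_odd psi2_incr psi1_submult
        psi2_supermult f_odd f_sign solves_on_subset[OF uvw]])
    have idx: "2 * k - 1 \<in> {1..2 * N + 1}" "2 * k \<in> {1..2 * N + 1}" "2 * k + 1 \<in> {1..2 * N + 1}"
      using k by auto
    show "u (t (2 * k - 1)) = 0" "u (t (2 * k)) = 0" "u (t (2 * k + 1)) = 0"
      using t_zero idx by blast+
    show "t (2 * k - 1) < t (2 * k)" "t (2 * k) < t (2 * k + 1)"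
      using k by (auto intro!: strict_mono_onD[OF t_incr] idx)
    show "{t (2 * k - 1)..t (2 * k + 1)} \<subseteq> {a..b}" "t (2 * k + 1) - t (2 * k - 1) \<le> b - a"
      using t_range[OF idx(1)] t_range[OF idx(3)] by auto
  qed (use nontriv_sub[OF k] in auto)
  moreover have "\<psi>2 ((2 / (b - a)) / \<psi>1 ((b - a) / 2)) > 0"
    using \<open>a < b\<close> odd_strict_mono_zero_and_sign(2)[of \<psi>1, OF psi1_odd psi1_incr]
      odd_strict_mono_zero_and_sign(2)[of \<psi>2, OF psi2_odd psi2_incr] by simp
  ultimately show ?thesis
    using card_less_cmult_sum[of "{1..N}"] \<open>N \<ge> 1\<close> by simp
qed

end
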